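(* Let $G$ be a finite simple graph of order $2n$ with a perfect matching, and suppose $F(G)=k$ where $0\leq k\leq n-1$. Then $$e(G)\geq \frac{n(n+1)}{n-k}-k-1.$$
   Context: For a graph $G$ with a perfect matching $M$, a subset $S\subseteq M$ is a forcing set of $M$ if $S$ is contained in no perfect matching of $G$ other than $M$. $f(G,M)$ is the minimum size of a forcing set of $M$, and $F(G)=\max_M f(G,M)$ over all perfect matchings $M$ of $G$. $e(G)$ is the number of edges. *)

theory Defs
  imports Complex_Main
begin

definition simple_graph :: "'a set \<Rightarrow> 'a set set \<Rightarrow> bool" where
  "simple_graph V E \<longleftrightarrow> finite V \<and> (\<forall>e\<in>E. e \<subseteq> V \<and> card e = 2)"

definition perfect_matching :: "'a set \<Rightarrow> 'a set set \<Rightarrow> 'a set set \<Rightarrow> bool" where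
  "perfect_matching V E M \<longleftrightarrow> M \<subseteq> E \<and> pairwise disjnt M \<and> \<Union>M = V"

definition forcing_set :: "'a set \<Rightarrow> 'a set set \<Rightarrow> 'a set set \<Rightarrow> 'a set set \<Rightarrow> bool" where
  "forcing_set V E M S \<longleftrightarrow>
     S \<subseteq> M \<and> (\<forall>M'. perfect_matching V E M' \<and> S \<subseteq> M' \<longrightarrow> M' = M)"

(* The set of sizes is nonempty: a perfect matching M is a forcing set of itself, because
   distinct perfect matchings are never nested. *)
definition forcing_number :: "'a set \<Rightarrow> 'a set set \<Rightarrow> 'a set set \<Rightarrow> nat" where
  "forcing_number V E M = Min (card ` {S. forcing_set V E M S})"

(* Max is meaningful only for a graph that has a perfect matching. *)
definition max_forcing_number :: "'a set \<Rightarrow> 'a set set \<Rightarrow> nat" where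
  "max_forcing_number V E = Max (forcing_number V E ` {M. perfect_matching V E M})"

end

theory Submission
  imports Defs
begin

text \<open>
  In every edge \<open>e\<close> of a perfect matching \<open>M\<close> choose the end \<open>x e\<close> of smaller degree, so that the
  degrees of the chosen ends sum to at most \<open>e(G)\<close>. Draw an arc from \<open>e\<close> to \<open>f\<close> whenever \<open>x e\<close>
  is adjacent to an end of \<open>f\<close>. If \<open>T \<subseteq> M\<close> induces an acyclic digraph, then \<open>M - T\<close> is a forcing
  set: a sink \<open>e\<close> among the edges of \<open>T\<close> missing from another perfect matching leaves \<open>x e\<close>
  without a partner. A greedy argument of Caro-Wei type gives such a \<open>T\<close> of size at least the sum
  of \<open>1 / deg (x e)\<close>, which is at least \<open>n\<^sup>2 / e(G)\<close>. Hence \<open>n - k \<ge> n\<^sup>2 / e(G)\<close>, and this is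
  stronger than the claimed bound because \<open>(n - k - 1) * k \<ge> 0\<close>.
\<close>

section \<open>Acyclic subsets and a sum of reciprocals\<close>

text \<open>Acyclicity of a reflexive relation on \<open>T\<close>, up to loops, is expressed by the existence of a
  sink in every nonempty subset.\<close>

lemma exists_large_acyclic_subset:
  fixes R :: "'b \<Rightarrow> 'b \<Rightarrow> bool"
  assumes "finite A" and "\<And>i. i \<in> A \<Longrightarrow> R i i"
  shows "\<exists>T\<subseteq>A. (\<Sum>i\<in>A. 1 / real (card {j\<in>A. R i j})) \<le> real (card T) \<and>
           (\<forall>U. U \<subseteq> T \<and> U \<noteq> {} \<longrightarrow> (\<exists>i\<in>U. \<forall>j\<in>U. R i j \<longrightarrow> j = i))"
  using assms
proof (induction A rule: finite_psubset_induct)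
  case (psubset A)
  show ?case
  proof (cases "A = {}")
    case True
    then show ?thesis by simp
  next
    case False
    let ?d = "\<lambda>B i. card {j\<in>B. R i j}"
    \<comment> \<open>Every member of \<open>N\<close> has out-degree at least \<open>card N\<close>
      by minimality of \<open>v\<close>, so \<open>N\<close> contributes at most 1 to the sum;
      adding \<open>v\<close> to the set \<open>T\<close> found in \<open>B\<close> pays for
      it.\<close>
    obtain v where v: "v \<in> A" and vmin: "\<And>i. i \<in> A \<Longrightarrow> ?d A v \<le> ?d A i"
      using arg_min_if_finite[OF psubset.hyps(1) False, of "?d A"]
      by (meson not_le)
    define N where "N = {j\<in>A. R v j}"
    define B where "B = A - N"
    have N: "N \<subseteq> A" "v \<in> N" "finite N"
      using v psubset.prems psubset.hyps by (auto simp: N_def)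
    have dpos: "0 < ?d C i" if "C \<subseteq> A" "i \<in> C" for C i
      using that psubset.prems psubset.hyps(1) by (auto simp: card_gt_0_iff intro: finite_subset)
    obtain T where T: "T \<subseteq> B" "(\<Sum>i\<in>B. 1 / real (?d B i)) \<le> real (card T)"
      and Tsink: "\<And>U. U \<subseteq> T \<Longrightarrow> U \<noteq> {} \<Longrightarrow> \<exists>i\<in>U. \<forall>j\<in>U. R i j \<longrightarrow> j = i"
    proof -
      have "B \<subset> A" using N v by (auto simp: B_def)
      from psubset.IH[OF this] psubset.prems show ?thesis
        using that B_def by auto
    qed
    have finT: "finite T" "v \<notin> T"
      using T(1) psubset.hyps N by (auto simp: B_def intro: finite_subset)
    have "(\<Sum>i\<in>N. 1 / real (?d A i)) \<le> (\<Sum>i\<in>N. 1 / real (card N))"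
    proof (rule sum_mono)
      fix i assume "i \<in> N"
      then have "card N \<le> ?d A i" using vmin N by (auto simp: N_def)
      moreover have "0 < card N" using N by (auto simp: card_gt_0_iff)
      ultimately show "1 / real (?d A i) \<le> 1 / real (card N)"
        by (intro divide_left_mono) auto
    qed
    also have "\<dots> = 1" using N by auto
    finally have sumN: "(\<Sum>i\<in>N. 1 / real (?d A i)) \<le> 1" .
    \<comment> \<open>Out-degrees can only drop from \<open>A\<close> to \<open>B\<close>, so the
      reciprocals grow and the bound obtained in \<open>B\<close> suffices.\<close>
    have sumB: "(\<Sum>i\<in>B. 1 / real (?d A i)) \<le> (\<Sum>i\<in>B. 1 / real (?d B i))"
    proof (rule sum_mono)
      fix i assume i: "i \<in> B"
      have "?d B i \<le> ?d A i"
        using psubset.hyps by (intro card_mono) (auto simp: B_def)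
      moreover have "0 < ?d B i" using i by (intro dpos) (auto simp: B_def)
      ultimately show "1 / real (?d A i) \<le> 1 / real (?d B i)"
        by (intro divide_left_mono) auto
    qed
    have "(\<Sum>i\<in>A. 1 / real (?d A i)) = (\<Sum>i\<in>B. 1 / real (?d A i)) + (\<Sum>i\<in>N. 1 / real (?d A i))"
      unfolding B_def using N psubset.hyps by (intro sum.subset_diff) auto
    then have "(\<Sum>i\<in>A. 1 / real (?d A i)) \<le> real (card (insert v T))"
      using sumN sumB T(2) finT by simp
    \<comment> \<open>All arcs from \<open>v\<close> end in \<open>N\<close>, which \<open>T\<close>
      avoids, so \<open>v\<close> is a sink of every \<open>U\<close> containing it.\<close>
    moreover have "\<exists>i\<in>U. \<forall>j\<in>U. R i j \<longrightarrow> j = i" if "U \<subseteq> insert v T" "U \<noteq> {}" for U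
    proof (cases "v \<in> U")
      case True
      moreover have "\<not> R v j" if "j \<in> T" for j
        using that T(1) by (auto simp: B_def N_def)
      ultimately show ?thesis using that(1) by blast
    next
      case False
      then show ?thesis using that Tsink[of U] by blast
    qed
    moreover have "insert v T \<subseteq> A" using v T(1) by (auto simp: B_def)
    ultimately show ?thesis by blast
  qed
qed

text \<open>The inequality between arithmetic and harmonic means, with the sum of the
  \<open>d i\<close> relaxed to \<open>s\<close>.\<close>

lemma sum_inverse_ge_square_div:
  fixes d :: "'b \<Rightarrow> real"
  assumes "finite A" and pos: "\<And>i. i \<in> A \<Longrightarrow> 0 < d i" and "(\<Sum>i\<in>A. d i) \<le> s" and "0 < s"
  shows "(real (card A))\<^sup>2 / s \<le> (\<Sum>i\<in>A. 1 / d i)"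
proof -
  define c where "c = real (card A) / s"
  \<comment> \<open>The tangent of \<open>1 / t\<close> at \<open>t = 1 / c\<close>, the value that all \<open>d i\<close> take in the equality case.\<close>
  have "2 * c - c\<^sup>2 * d i \<le> 1 / d i" if "i \<in> A" for i
  proof -
    have "0 \<le> (c * d i - 1)\<^sup>2" by simp
    then show ?thesis using pos[OF that]
      by (simp add: field_simps power2_eq_square)
  qed
  then have "(\<Sum>i\<in>A. 2 * c - c\<^sup>2 * d i) \<le> (\<Sum>i\<in>A. 1 / d i)"
    by (rule sum_mono)
  moreover have "(\<Sum>i\<in>A. 2 * c - c\<^sup>2 * d i) = 2 * c * real (card A) - c\<^sup>2 * (\<Sum>i\<in>A. d i)"
    by (simp add: sum_subtractf sum_distrib_left)
  moreover have "c\<^sup>2 * (\<Sum>i\<in>A. d i) \<le> c\<^sup>2 * s"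
    using assms(3) by (intro mult_left_mono) auto
  moreover have "2 * c * real (card A) - c\<^sup>2 * s = (real (card A))\<^sup>2 / s"
    using \<open>0 < s\<close> by (simp add: c_def field_simps power2_eq_square)
  ultimately show ?thesis by linarith
qed

section \<open>Degrees and perfect matchings\<close>

lemma finite_edges:
  assumes "simple_graph V E"
  shows "finite E"
proof (rule finite_subset)
  show "E \<subseteq> Pow V" "finite (Pow V)" using assms by (auto simp: simple_graph_def)
qed

lemma sum_degrees:
  assumes "simple_graph V E"
  shows "(\<Sum>v\<in>V. card {g\<in>E. v \<in> g}) = 2 * card E"
proof -
  have "finite V" using assms by (simp add: simple_graph_def)
  moreover have "\<forall>g\<in>E. card {v\<in>V. v \<in> g} = 2"
  proof
    fix g assume "g \<in> E"
    then have "{v\<in>V. v \<in> g} = g" "card g = 2" using assms by (auto simp: simple_graph_def)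
    then show "card {v\<in>V. v \<in> g} = 2" by simp
  qed
  ultimately show ?thesis
    using sum_multicount[of V E "\<lambda>v g. v \<in> g" 2] finite_edges[OF assms] by simp
qed

lemma perfect_matching_edge:
  assumes "simple_graph V E" and "perfect_matching V E M" and "e \<in> M"
  shows "e \<in> E" and "e \<subseteq> V" and "card e = 2"
  using assms by (auto simp: simple_graph_def perfect_matching_def)

lemma perfect_matching_unique_edge:
  assumes "perfect_matching V E M" and "e \<in> M" and "f \<in> M" and "v \<in> e" and "v \<in> f"
  shows "e = f"
  using assms by (auto simp: perfect_matching_def pairwise_def disjnt_def)

text \<open>The edges of \<open>M\<close> partition \<open>V\<close>. Weight 1 will count the
  vertices; the degree as weight will split the handshake sum along \<open>M\<close>.\<close>

lemma perfect_matching_sum: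
  assumes "simple_graph V E" and "perfect_matching V E M"
  shows "(\<Sum>v\<in>V. w v) = (\<Sum>e\<in>M. \<Sum>v\<in>e. w v)"
proof -
  \<comment> \<open>Infinite sets have \<open>card\<close> 0 by convention, so
    \<open>card e = 2\<close> implies finiteness.\<close>
  have "\<forall>e\<in>M. finite e"
    using perfect_matching_edge(3)[OF assms] by (metis card.infinite zero_neq_numeral)
  moreover have "\<forall>e\<in>M. \<forall>f\<in>M. e \<noteq> f \<longrightarrow> e \<inter> f = {}"
    using perfect_matching_unique_edge[OF assms(2)] by blast
  moreover have "V = \<Union>M" using assms(2) by (simp add: perfect_matching_def)
  ultimately show ?thesis by (simp add: sum.Union_disjoint)
qed

lemma card_perfect_matching:
  assumes "simple_graph V E" and "perfect_matching V E M"
  shows "card V = 2 * card M"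
proof -
  have "card V = (\<Sum>e\<in>M. card e)"
    using perfect_matching_sum[OF assms, of "\<lambda>_. 1::nat"] by simp
  also have "\<dots> = 2 * card M"
    using perfect_matching_edge(3)[OF assms] by simp
  finally show ?thesis .
qed

text \<open>All perfect matchings have the same size, half of \<open>card V\<close>.\<close>

lemma perfect_matching_subset_eq:
  assumes "simple_graph V E" and "perfect_matching V E M" and "perfect_matching V E M'"
    and "M \<subseteq> M'"
  shows "M' = M"
proof -
  have "finite M'"
    using assms(3) finite_edges[OF assms(1)] by (auto simp: perfect_matching_def intro: finite_subset)
  then show ?thesis
    using card_perfect_matching[OF assms(1)] assms by (metis card_subset_eq mult_cancel1 zero_neq_numeral)
qed

section \<open>Forcing sets from acyclic digraphs\<close>

lemma forcing_set_Diff_acyclic: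
  assumes G: "simple_graph V E" and M: "perfect_matching V E M"
    and x: "\<And>e. e \<in> M \<Longrightarrow> x e \<in> e"
    and sink: "\<And>U. U \<subseteq> T \<Longrightarrow> U \<noteq> {} \<Longrightarrow>
                 \<exists>e\<in>U. \<forall>f\<in>U. (\<exists>z\<in>f. {x e, z} \<in> E) \<longrightarrow> f = e"
  shows "forcing_set V E M (M - T)"
  unfolding forcing_set_def
proof (intro conjI allI impI)
  fix M' assume "perfect_matching V E M' \<and> M - T \<subseteq> M'"
  then have M': "perfect_matching V E M'" and sub: "M - T \<subseteq> M'" by auto
  show "M' = M"
  proof (rule ccontr)
    assume "M' \<noteq> M"
    then have "M - M' \<noteq> {}"
      using perfect_matching_subset_eq[OF G M M'] by blast
    \<comment> \<open>Since \<open>M - T\<close> lies in \<open>M'\<close>, the set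
      \<open>M - M'\<close> is a nonempty subset of \<open>T\<close> and has a sink.\<close>
    then obtain e where e: "e \<in> M" "e \<notin> M'"
      and esink: "\<And>f z. f \<in> M - M' \<Longrightarrow> z \<in> f \<Longrightarrow> {x e, z} \<in> E \<Longrightarrow> f = e"
      using sink[of "M - M'"] sub by blast
    have "x e \<in> V" using x[OF e(1)] perfect_matching_edge(2)[OF G M e(1)] by blast
    then obtain g where g: "g \<in> M'" "x e \<in> g"
      using M' by (auto simp: perfect_matching_def)
    obtain z where z: "g = {x e, z}" "z \<noteq> x e"
      using perfect_matching_edge(3)[OF G M' g(1)] g(2) by (auto simp: card_2_iff doubleton_eq_iff)
    have "{x e, z} \<in> E" "z \<in> V"
      using perfect_matching_edge[OF G M' g(1)] z by auto
    then obtain f where f: "f \<in> M" "z \<in> f"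
      using M by (auto simp: perfect_matching_def)
    \<comment> \<open>If \<open>f\<close> is in \<open>M'\<close>, it shares \<open>z\<close> with
      \<open>g\<close>, so \<open>f = g\<close> contains \<open>x e\<close> and equals
      \<open>e\<close>. Otherwise \<open>g\<close> yields an arc from the sink \<open>e\<close> to
      \<open>f\<close>, so \<open>f = e\<close> and then \<open>g = e\<close>. Both put
      \<open>e\<close> into \<open>M'\<close>.\<close>
    show False
    proof (cases "f \<in> M'")
      case True
      then have "f = g" using perfect_matching_unique_edge[OF M' True g(1) f(2)] z by auto
      then have "f = e"
        using perfect_matching_unique_edge[OF M f(1) e(1) _ x[OF e(1)]] g(2) by auto
      then show False using True e by simp
    next
      case False
      then have "f = e" using esink f \<open>{x e, z} \<in> E\<close> by blast
      then have "g \<subseteq> e" using z x[OF e(1)] f by auto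
      moreover have "card e = 2" "card g = 2"
        using perfect_matching_edge(3)[OF G M e(1)] perfect_matching_edge(3)[OF G M' g(1)] by auto
      ultimately have "g = e"
        by (metis card_subset_eq card.infinite zero_neq_numeral)
      then show False using g e by simp
    qed
  qed
qed auto

text \<open>Matching edges are disjoint, so choosing a neighbour of \<open>v\<close> on each of them
  gives distinct edges at \<open>v\<close>. This bounds out-degrees in the digraph by degrees in the
  graph.\<close>

lemma card_adjacent_matching_edges_le_degree:
  assumes "finite E" and M: "perfect_matching V E M"
  shows "card {f\<in>M. \<exists>z\<in>f. {v, z} \<in> E} \<le> card {g\<in>E. v \<in> g}"
proof -
  let ?A = "{f\<in>M. \<exists>z\<in>f. {v, z} \<in> E}"
  have "\<forall>f\<in>?A. \<exists>z. z \<in> f \<and> {v, z} \<in> E" by blast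
  from bchoice[OF this] obtain h where h: "\<And>f. f \<in> ?A \<Longrightarrow> h f \<in> f \<and> {v, h f} \<in> E"
    by blast
  have "inj_on (\<lambda>f. {v, h f}) ?A"
  proof (rule inj_onI)
    fix e f assume ef: "e \<in> ?A" "f \<in> ?A" "{v, h e} = {v, h f}"
    then have "h e = h f" by (auto simp: doubleton_eq_iff)
    then have "h e \<in> e" "h e \<in> f" using h[OF ef(1)] h[OF ef(2)] by auto
    then show "e = f" using perfect_matching_unique_edge[OF M] ef(1,2) by blast
  qed
  moreover have "(\<lambda>f. {v, h f}) ` ?A \<subseteq> {g\<in>E. v \<in> g}" using h by blast
  ultimately show ?thesis using assms(1) by (intro card_inj_on_le) auto
qed

lemma forcing_number_le_card:
  assumes "finite M" and "forcing_set V E M S"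
  shows "forcing_number V E M \<le> card S"
  unfolding forcing_number_def
proof (rule Min_le)
  have "{S. forcing_set V E M S} \<subseteq> Pow M" by (auto simp: forcing_set_def)
  then show "finite (card ` {S. forcing_set V E M S})"
    using assms(1) by (meson finite_Pow_iff finite_imageI finite_subset)
qed (use assms in auto)

section \<open>The bound on the number of edges\<close>

lemma square_div_card_edges_le:
  assumes G: "simple_graph V E" and M: "perfect_matching V E M" and "M \<noteq> {}"
  shows "(real (card M))\<^sup>2 / real (card E) \<le> real (card M) - real (forcing_number V E M)"
proof -
  let ?deg = "\<lambda>v. card {g\<in>E. v \<in> g}"
  have finE: "finite E" using finite_edges[OF G] .
  have finM: "finite M" using M finE by (auto simp: perfect_matching_def intro: finite_subset)
  have "\<exists>v\<in>e. \<forall>w\<in>e. ?deg v \<le> ?deg w" if "e \<in> M" for e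
  proof -
    have "finite e" "e \<noteq> {}"
      using perfect_matching_edge(3)[OF G M that] by (auto intro: card_ge_0_finite)
    from arg_min_if_finite[OF this, of ?deg] show ?thesis by (meson not_le)
  qed
  then obtain x where x: "\<And>e. e \<in> M \<Longrightarrow> x e \<in> e"
    and xmin: "\<And>e w. e \<in> M \<Longrightarrow> w \<in> e \<Longrightarrow> ?deg (x e) \<le> ?deg w"
    by metis
  let ?R = "\<lambda>e f. \<exists>z\<in>f. {x e, z} \<in> E"
  \<comment> \<open>The edge \<open>e\<close> itself joins \<open>x e\<close> to its other end; this
    loop keeps every out-degree positive.\<close>
  have refl: "?R e e" if e: "e \<in> M" for e
  proof -
    obtain z where "e = {x e, z}"
      using perfect_matching_edge(3)[OF G M e] x[OF e] by (auto simp: card_2_iff doubleton_eq_iff)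
    then show ?thesis using perfect_matching_edge(1)[OF G M e]
      by (metis insertI1 insert_commute)
  qed
  obtain T where T: "T \<subseteq> M" "(\<Sum>e\<in>M. 1 / real (card {f\<in>M. ?R e f})) \<le> real (card T)"
    and sink: "\<And>U. U \<subseteq> T \<Longrightarrow> U \<noteq> {} \<Longrightarrow> \<exists>e\<in>U. \<forall>f\<in>U. ?R e f \<longrightarrow> f = e"
  proof -
    show ?thesis
      using exists_large_acyclic_subset[of M ?R, OF finM refl] that by auto
  qed
  have "forcing_set V E M (M - T)"
    using forcing_set_Diff_acyclic[OF G M x sink] .
  then have "forcing_number V E M \<le> card M - card T"
    using forcing_number_le_card[OF finM] T(1) finM by (metis card_Diff_subset finite_subset)
  moreover have "card T \<le> card M" using T(1) finM by (simp add: card_mono)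
  ultimately have TM: "real (card T) \<le> real (card M) - real (forcing_number V E M)" by linarith
  have Rpos: "0 < card {f\<in>M. ?R e f}" if "e \<in> M" for e
    using refl[OF that] that finM by (auto simp: card_gt_0_iff)
  have Rdeg: "card {f\<in>M. ?R e f} \<le> ?deg (x e)" for e
    using card_adjacent_matching_edges_le_degree[OF finE M] .
  \<comment> \<open>Both ends of \<open>e\<close> have degree at least that of \<open>x e\<close>,
    so the handshake sum \<open>2 * card E\<close> is at least twice the sum of the chosen
    degrees.\<close>
  have "2 * (\<Sum>e\<in>M. ?deg (x e)) = (\<Sum>e\<in>M. \<Sum>v\<in>e. ?deg (x e))"
    using perfect_matching_edge(3)[OF G M] by (simp add: sum_distrib_left)
  also have "\<dots> \<le> (\<Sum>e\<in>M. \<Sum>v\<in>e. ?deg v)"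
    using xmin by (intro sum_mono)
  also have "\<dots> = 2 * card E"
    using perfect_matching_sum[OF G M, of ?deg] sum_degrees[OF G] by simp
  finally have "(\<Sum>e\<in>M. card {f\<in>M. ?R e f}) \<le> card E"
    using sum_mono[of M "\<lambda>e. card {f\<in>M. ?R e f}" "\<lambda>e. ?deg (x e)"] Rdeg by fastforce
  then have "(\<Sum>e\<in>M. real (card {f\<in>M. ?R e f})) \<le> real (card E)"
    by (simp flip: of_nat_sum)
  moreover have "0 < card E"
    using \<open>M \<noteq> {}\<close> M finE by (auto simp: perfect_matching_def card_gt_0_iff)
  ultimately have "(real (card M))\<^sup>2 / real (card E) \<le> (\<Sum>e\<in>M. 1 / real (card {f\<in>M. ?R e f}))"
    using Rpos finM by (intro sum_inverse_ge_square_div) auto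
  then show ?thesis using T(2) TM by linarith
qed

theorem theorem3p4:
  fixes V :: "'a set" and E :: "'a set set" and n k :: nat
  assumes "simple_graph V E"
    and "card V = 2 * n"
    and "\<exists>M. perfect_matching V E M"
    and "max_forcing_number V E = k"
    and "0 \<le> k" and "k < n"
  shows "real (card E) \<ge> real n * (real n + 1) / (real n - real k) - real k - 1"
proof -
  have "{M. perfect_matching V E M} \<subseteq> Pow E" by (auto simp: perfect_matching_def)
  then have "finite {M. perfect_matching V E M}"
    using finite_edges[OF assms(1)] by (meson finite_Pow_iff finite_subset)
  \<comment> \<open>The maximum is attained because there are finitely many perfect matchings and at
    least one.\<close>
  then have "k \<in> forcing_number V E ` {M. perfect_matching V E M}"
    using assms(3,4) Max_in[of "forcing_number V E ` {M. perfect_matching V E M}"]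
    by (auto simp: max_forcing_number_def)
  then obtain M where M: "perfect_matching V E M" "forcing_number V E M = k" by auto
  have n: "card M = n" using card_perfect_matching[OF assms(1) M(1)] assms(2) by simp
  then have "M \<noteq> {}" using assms(6) by auto
  then have "(real n)\<^sup>2 / real (card E) \<le> real n - real k"
    using square_div_card_edges_le[OF assms(1) M(1)] M(2) n by simp
  moreover have "0 < card E"
    using \<open>M \<noteq> {}\<close> M(1) finite_edges[OF assms(1)]
    by (auto simp: perfect_matching_def card_gt_0_iff)
  moreover have m: "0 < real n - real k" using assms(6) by simp
  ultimately have "(real n)\<^sup>2 / (real n - real k) \<le> real (card E)"
    by (simp add: field_simps)
  \<comment> \<open>The fractions differ by \<open>n / (n - k)\<close>, which is at most
    \<open>k + 1\<close> because \<open>(k + 1) * (n - k) = n + (n - k - 1) * k\<close>; integrality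
    turns \<open>k < n\<close> into \<open>n - k - 1 \<ge> 0\<close>.\<close>
  moreover have "real n * (real n + 1) / (real n - real k) - real k - 1
                  \<le> (real n)\<^sup>2 / (real n - real k)"
  proof -
    have "0 \<le> (real n - real k - 1) * real k" using assms(6) by simp
    then have "real n \<le> (real k + 1) * (real n - real k)" by (simp add: algebra_simps)
    then have "real n / (real n - real k) \<le> real k + 1"
      using m by (simp add: pos_divide_le_eq)
    then show ?thesis by (simp add: power2_eq_square distrib_left add_divide_distrib)
  qed
  ultimately show ?thesis by linarith
qed

end
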